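(* Let $H$ be a complex Hilbert space with $\dim(H)\ge 2$, let $\{\theta_j\}_{j\in\mathbb{N}}$ be a sequence in $\mathbb{T}$ with $\theta_1\neq\theta_2$, and let $\Theta=\{\theta_j\}_{j\in\mathbb{N}}\subseteq\mathbb{T}$. Let $\mathbf{G}\subseteq H$ be non-empty. Then $\mathbf{G}$ fails $\Theta$-PR if and only if there exist a cover $\{\mathbf{G}_j\}_{j\in\mathbb{N}}$ of $\mathbf{G}$ and a sequence $\{x_j\}_{j\in\mathbb{N}}\subseteq H$ satisfying: 1. $0\neq x_j\in\mathbf{G}_j^\perp$ for every $j\in\mathbb{N}$; 2. $x_1$ and $x_2$ are linearly independent; 3. for every $j\ge 3$, $$x_j=\frac{\theta_j-\theta_1}{\theta_2-\theta_1}\,x_2-\frac{\theta_j-\theta_2}{\theta_2-\theta_1}\,x_1 .$$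
   Context: $\mathbb{T}=\{z\in\mathbb{C}:|z|=1\}$ and $\mathbb{N}=\{1,2,3,\dots\}$. The inner product $\langle\cdot,\cdot\rangle$ is linear in the first and conjugate linear in the second argument. For $\Theta\subseteq\mathbb{T}$, a set $\mathbf{G}\subseteq H$ does $\Theta$-PR (in $H$) if for all $f,h\in H$ the following holds: if for every $g\in\mathbf{G}$ there exists $\theta_g\in\Theta$ with $\langle f,g\rangle=\theta_g\langle h,g\rangle$, then $f=\theta h$ for some $\theta\in\Theta$. $\mathbf{G}$ fails $\Theta$-PR if it does not do $\Theta$-PR. $\{\mathbf{G}_j\}_{j\in\mathbb{N}}$ is a cover of $\mathbf{G}$ if $\mathbf{G}_j\subseteq\mathbf{G}$ for every $j$ and $\bigcup_{j}\mathbf{G}_j=\mathbf{G}$ (the sets $\mathbf{G}_j$ may overlap and may be empty). $X^\perp$ denotes the orthogonal complement of $X\subseteq H$. The sequence $\{\theta_j\}$ may contain repetitions, so finite sets $\Theta$ with at least two elements are included. *)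

theory Defs
  imports "HOL-Analysis.Analysis"
begin

text \<open>
  Complex inner product spaces, with the inner product linear in the first and conjugate linear
  in the second argument. The underlying class \<open>real_normed_vector\<close> supplies the
  metric; its norm and its real scaling are the ones induced by the complex structure.
\<close>

class complex_inner = real_normed_vector +
  fixes scaleC :: "complex \<Rightarrow> 'a \<Rightarrow> 'a" (infixr "*\<^sub>C" 75)
    and cinner :: "'a \<Rightarrow> 'a \<Rightarrow> complex"
  assumes scaleC_add_right: "a *\<^sub>C (x + y) = a *\<^sub>C x + a *\<^sub>C y"
    and scaleC_add_left: "(a + b) *\<^sub>C x = a *\<^sub>C x + b *\<^sub>C x"
    and scaleC_scaleC: "a *\<^sub>C b *\<^sub>C x = (a * b) *\<^sub>C x"
    and scaleC_one: "1 *\<^sub>C x = x"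
    and scaleR_scaleC: "r *\<^sub>R x = complex_of_real r *\<^sub>C x"
    and cinner_add_left: "cinner (x + y) z = cinner x z + cinner y z"
    and cinner_scaleC_left: "cinner (a *\<^sub>C x) y = a * cinner x y"
    and cinner_commute: "cinner x y = cnj (cinner y x)"
    and cinner_ge_zero: "0 \<le> Re (cinner x x)"
    and cinner_eq_zero_iff: "cinner x x = 0 \<longleftrightarrow> x = 0"
    and norm_eq_sqrt_cinner: "norm x = sqrt (Re (cinner x x))"

class chilbert_space = complex_inner + complete_space

global_interpretation complex_vector:
  vector_space "scaleC :: complex \<Rightarrow> 'a \<Rightarrow> 'a::complex_inner"
  by unfold_locales
    (simp_all add: scaleC_add_right scaleC_add_left scaleC_scaleC scaleC_one)

text \<open>
  \<open>complex_vector.dim UNIV\<close> is \<open>0\<close> for infinite-dimensional spaces, so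
  a lower bound on the dimension is expressed through a basis.
\<close>

definition cdim_at_least :: "nat \<Rightarrow> 'a::complex_inner itself \<Rightarrow> bool" where
  "cdim_at_least n _ \<longleftrightarrow>
     (\<exists>B :: 'a set. complex_vector.independent B \<and> complex_vector.span B = UNIV \<and>
        (infinite B \<or> n \<le> card B))"

definition orth_compl :: "'a::complex_inner set \<Rightarrow> 'a set" where
  "orth_compl X = {y. \<forall>x\<in>X. cinner y x = 0}"

definition does_PR :: "complex set \<Rightarrow> 'a::complex_inner set \<Rightarrow> bool" where
  "does_PR \<Theta> G \<longleftrightarrow>
     (\<forall>f h. (\<forall>g\<in>G. \<exists>t\<in>\<Theta>. cinner f g = t * cinner h g) \<longrightarrow> (\<exists>t\<in>\<Theta>. f = t *\<^sub>C h))"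

text \<open>Sequences are indexed by the positive integers; the value at \<open>0\<close> is ignored.\<close>

definition is_cover :: "(nat \<Rightarrow> 'a set) \<Rightarrow> 'a set \<Rightarrow> bool" where
  "is_cover C G \<longleftrightarrow> (\<forall>j\<ge>1. C j \<subseteq> G) \<and> (\<Union>j\<in>{1..}. C j) = G"

text \<open>The clause \<open>x \<noteq> y\<close> is needed because \<open>{x, x}\<close> is a singleton.\<close>

definition lin_indep_pair :: "'a::complex_inner \<Rightarrow> 'a \<Rightarrow> bool" where
  "lin_indep_pair x y \<longleftrightarrow> x \<noteq> y \<and> complex_vector.independent {x, y}"

end

theory Submission
  imports Defs
begin

text \<open>
  The two sides are related by \<open>x j = f - \<theta> j *\<^sub>C h\<close>: the vectors \<open>x 1\<close> and \<open>x 2\<close> determine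
  \<open>f\<close> and \<open>h\<close>, the formula for \<open>j \<ge> 3\<close> says that the remaining \<open>x j\<close> come from the same pair,
  and \<open>cinner f g = \<theta> j * cinner h g\<close> means that \<open>x j\<close> is orthogonal to \<open>g\<close>.
  A counterexample \<open>f, h\<close> to phase retrieval yields linearly dependent \<open>x 1, x 2\<close> only if all
  \<open>x j\<close> are non-zero multiples of \<open>x 1\<close>, so that \<open>x 1\<close> is orthogonal to all of \<open>G\<close>; then
  the cover by \<open>G\<close> and empty sets works, with any \<open>x 2\<close> independent of \<open>x 1\<close>.
\<close>

lemma cinner_zero_left [simp]: "cinner 0 x = 0"
  using cinner_scaleC_left[of 0 0 x] by simp

lemma cinner_diff_left: "cinner (x - y) z = cinner x z - cinner y z"
  using cinner_add_left[of "x - y" y z] by simp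

lemma lin_indep_pair_iff:
  assumes "x \<noteq> 0"
  shows "lin_indep_pair x y \<longleftrightarrow> (\<forall>c. y \<noteq> c *\<^sub>C x)"
proof -
  have "y = x \<Longrightarrow> y = 1 *\<^sub>C x"
    by simp
  moreover have "complex_vector.independent {y, x} \<longleftrightarrow> (\<forall>c. y \<noteq> c *\<^sub>C x)" if "y \<noteq> x"
    using that assms
    by (auto simp: complex_vector.independent_insert complex_vector.span_singleton)
  ultimately show ?thesis
    unfolding lin_indep_pair_def by (metis insert_commute)
qed

lemma lin_indep_pair_combination_nonzero:
  assumes "lin_indep_pair x y" and "x \<noteq> 0" and "a \<noteq> 0 \<or> b \<noteq> 0"
  shows "a *\<^sub>C y - b *\<^sub>C x \<noteq> 0"
proof
  assume *: "a *\<^sub>C y - b *\<^sub>C x = 0"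
  show False
  proof (cases "a = 0")
    case True
    then show False using * assms by simp
  next
    case False
    then have "y = inverse a *\<^sub>C (a *\<^sub>C y)"
      by (simp add: scaleC_scaleC scaleC_one)
    also have "\<dots> = (inverse a * b) *\<^sub>C x"
      using * by (simp add: scaleC_scaleC)
    finally show False
      using assms lin_indep_pair_iff by blast
  qed
qed

text \<open>An independent set inside the line spanned by \<open>u\<close> is finite with at most
  one element, so some element of a basis lies off that line.\<close>

lemma cdim_at_least_2_obtains_independent:
  fixes u :: "'a::complex_inner"
  assumes "cdim_at_least 2 TYPE('a)" and "u \<noteq> 0"
  obtains v where "lin_indep_pair u v"
proof -
  obtain B :: "'a set" where B: "complex_vector.independent B" "infinite B \<or> 2 \<le> card B"
    using assms(1) unfolding cdim_at_least_def by blast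
  have "\<not> B \<subseteq> complex_vector.span {u}"
    using complex_vector.independent_span_bound[of "{u}" B] B by auto
  then obtain v where "v \<notin> complex_vector.span {u}"
    by blast
  then show thesis
    using that assms(2) by (auto simp: lin_indep_pair_iff complex_vector.span_singleton)
qed

text \<open>Lagrange interpolation at the nodes \<open>p\<close> and \<open>q\<close>, exact because
  the expression is affine in \<open>t\<close>.\<close>

lemma diff_scaleC_interpolate:
  fixes f h :: "'a::complex_inner"
  assumes "p \<noteq> q"
  shows "f - t *\<^sub>C h = ((t - p) / (q - p)) *\<^sub>C (f - q *\<^sub>C h) - ((t - q) / (q - p)) *\<^sub>C (f - p *\<^sub>C h)"
proof -
  have "(t - p) / (q - p) - (t - q) / (q - p) = 1"
    and "(t - p) / (q - p) * q - (t - q) / (q - p) * p = t"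
    using assms by (simp_all add: divide_simps) (simp add: algebra_simps)
  then have "f - t *\<^sub>C h = ((t - p) / (q - p) - (t - q) / (q - p)) *\<^sub>C f
      - ((t - p) / (q - p) * q - (t - q) / (q - p) * p) *\<^sub>C h"
    by (simp add: scaleC_one)
  then show ?thesis
    by (simp only: complex_vector.scale_right_diff_distrib complex_vector.scale_left_diff_distrib
        scaleC_scaleC) (simp add: algebra_simps)
qed

theorem theorem1p3:
  fixes \<theta> :: "nat \<Rightarrow> complex" and \<Theta> :: "complex set"
    and G :: "'a::chilbert_space set"
  assumes "cdim_at_least 2 TYPE('a)"
    and "\<forall>j\<ge>1. \<theta> j \<in> sphere 0 1"
    and "\<theta> 1 \<noteq> \<theta> 2"
    and "\<Theta> = \<theta> ` {1..}"
    and "G \<noteq> {}"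
  shows "\<not> does_PR \<Theta> G \<longleftrightarrow>
    (\<exists>(C :: nat \<Rightarrow> 'a set) (x :: nat \<Rightarrow> 'a).
       is_cover C G \<and>
       (\<forall>j\<ge>1. x j \<noteq> 0 \<and> x j \<in> orth_compl (C j)) \<and>
       lin_indep_pair (x 1) (x 2) \<and>
       (\<forall>j\<ge>3. x j = ((\<theta> j - \<theta> 1) / (\<theta> 2 - \<theta> 1)) *\<^sub>C x 2
                    - ((\<theta> j - \<theta> 2) / (\<theta> 2 - \<theta> 1)) *\<^sub>C x 1))"
    (is "_ \<longleftrightarrow> (\<exists>C x. ?P C x)")
proof
  assume "\<not> does_PR \<Theta> G"
  then obtain f h where fh: "\<And>g. g \<in> G \<Longrightarrow> \<exists>t\<in>\<Theta>. cinner f g = t * cinner h g"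
    and ne: "\<And>t. t \<in> \<Theta> \<Longrightarrow> f \<noteq> t *\<^sub>C h"
    unfolding does_PR_def by blast
  define x where "x j = f - \<theta> j *\<^sub>C h" for j
  have x_ne: "x j \<noteq> 0" if "j \<ge> 1" for j
    using ne[of "\<theta> j"] that assms(4) by (auto simp: x_def)
  have x_eq: "x j = ((\<theta> j - \<theta> 1) / (\<theta> 2 - \<theta> 1)) *\<^sub>C x 2
                    - ((\<theta> j - \<theta> 2) / (\<theta> 2 - \<theta> 1)) *\<^sub>C x 1" for j
    unfolding x_def by (rule diff_scaleC_interpolate[OF assms(3)])
  have x_orth: "\<exists>j\<ge>1. cinner (x j) g = 0" if "g \<in> G" for g
    using fh[OF that] assms(4) by (auto simp: x_def cinner_diff_left cinner_scaleC_left)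
  show "\<exists>C x. ?P C x"
  proof (cases "lin_indep_pair (x 1) (x 2)")
    case True
    \<comment> \<open>The largest subset of \<open>G\<close> orthogonal to \<open>x j\<close>; each
      \<open>g\<close> lies in the set whose index provides its phase.\<close>
    define C where "C j = {g \<in> G. cinner (x j) g = 0}" for j
    have "is_cover C G"
      using x_orth by (fastforce simp: is_cover_def C_def)
    moreover have "x j \<in> orth_compl (C j)" for j
      by (simp add: orth_compl_def C_def)
    ultimately show ?thesis
      using True x_ne x_eq by blast
  next
    case False
    then obtain c where c: "x 2 = c *\<^sub>C x 1"
      using lin_indep_pair_iff x_ne by blast
    have orth: "cinner (x 1) g = 0" if g: "g \<in> G" for g
    proof -
      obtain j where j: "j \<ge> 1" "cinner (x j) g = 0"
        using x_orth g by blast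
      \<comment> \<open>By interpolation \<open>x j\<close> lies on the line through
        \<open>x 1\<close>; as \<open>x j\<close> is non-zero, so is \<open>d\<close>, and
        orthogonality passes from \<open>x j\<close> to \<open>x 1\<close>.\<close>
      obtain d where "x j = d *\<^sub>C x 1"
        using x_eq[of j] unfolding c
        by (metis scaleC_scaleC complex_vector.scale_left_diff_distrib)
      with j x_ne[OF j(1)] show ?thesis
        by (auto simp: cinner_scaleC_left)
    qed
    obtain v where v: "lin_indep_pair (x 1) v"
      using cdim_at_least_2_obtains_independent assms(1) x_ne by blast
    \<comment> \<open>From index 3 on, the required formula forces the values. Only
      \<open>y 1\<close> has to be orthogonal to anything, the other sets of the cover being
      empty.\<close>
    define y where "y j = (if j = 1 then x 1 else if j = 2 then v else
      ((\<theta> j - \<theta> 1) / (\<theta> 2 - \<theta> 1)) *\<^sub>C v - ((\<theta> j - \<theta> 2) / (\<theta> 2 - \<theta> 1)) *\<^sub>C x 1)" for j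
    define C where "C j = (if j = 1 then G else {})" for j :: nat
    have "v \<noteq> 0"
      using v x_ne[of 1] lin_indep_pair_iff[of "x 1" v] complex_vector.scale_zero_left[of "x 1"]
      by auto
    \<comment> \<open>The two coefficients cannot both vanish, because \<open>\<theta> 1\<close> and
      \<open>\<theta> 2\<close> differ.\<close>
    moreover have "((\<theta> j - \<theta> 1) / (\<theta> 2 - \<theta> 1)) *\<^sub>C v
        - ((\<theta> j - \<theta> 2) / (\<theta> 2 - \<theta> 1)) *\<^sub>C x 1 \<noteq> 0" for j
      using assms(3) by (intro lin_indep_pair_combination_nonzero v x_ne) auto
    ultimately have "y j \<noteq> 0" for j
      using x_ne[of 1] by (simp add: y_def)
    moreover have "y j \<in> orth_compl (C j)" for j
      using orth by (simp add: orth_compl_def C_def y_def)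
    moreover have "is_cover C G"
      by (auto simp: is_cover_def C_def)
    moreover have "lin_indep_pair (y 1) (y 2)"
      using v by (simp add: y_def)
    ultimately have "?P C y"
      by (simp add: y_def)
    then show ?thesis
      by blast
  qed
next
  assume "\<exists>C x. ?P C x"
  then obtain C x where cover: "is_cover C G"
    and x: "\<And>j. j \<ge> 1 \<Longrightarrow> x j \<noteq> 0 \<and> x j \<in> orth_compl (C j)"
    and x_eq: "\<And>j. j \<ge> 3 \<Longrightarrow> x j = ((\<theta> j - \<theta> 1) / (\<theta> 2 - \<theta> 1)) *\<^sub>C x 2
                    - ((\<theta> j - \<theta> 2) / (\<theta> 2 - \<theta> 1)) *\<^sub>C x 1"
    by blast
  \<comment> \<open>Solution of the system \<open>x 1 = f - \<theta> 1 *\<^sub>C h\<close>,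
    \<open>x 2 = f - \<theta> 2 *\<^sub>C h\<close>: subtracting eliminates
    \<open>f\<close>.\<close>
  define h where "h = inverse (\<theta> 1 - \<theta> 2) *\<^sub>C (x 2 - x 1)"
  define f where "f = x 1 + \<theta> 1 *\<^sub>C h"
  have x1: "x 1 = f - \<theta> 1 *\<^sub>C h"
    by (simp add: f_def)
  have "(\<theta> 1 - \<theta> 2) *\<^sub>C h = x 2 - x 1"
    using assms(3) by (simp add: h_def scaleC_scaleC scaleC_one)
  then have x2: "x 2 = f - \<theta> 2 *\<^sub>C h"
    by (simp add: f_def complex_vector.scale_left_diff_distrib algebra_simps)
  have xj: "x j = f - \<theta> j *\<^sub>C h" if j: "j \<ge> 1" for j
  proof -
    consider "j = 1" | "j = 2" | "j \<ge> 3"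
      using j by linarith
    then show ?thesis
    proof cases
      case 3
      then show ?thesis
        using x_eq diff_scaleC_interpolate[OF assms(3), of f "\<theta> j" h] x1 x2 by simp
    qed (use x1 x2 in simp_all)
  qed
  have "\<exists>t\<in>\<Theta>. cinner f g = t * cinner h g" if g: "g \<in> G" for g
  proof -
    obtain j where j: "j \<ge> 1" "g \<in> C j"
      using cover g unfolding is_cover_def by blast
    then have "cinner (f - \<theta> j *\<^sub>C h) g = 0"
      using x[of j] xj[of j] by (simp add: orth_compl_def)
    then show ?thesis
      using j assms(4) by (auto simp: cinner_diff_left cinner_scaleC_left)
  qed
  \<comment> \<open>If \<open>t = \<theta> j\<close>, equality would give
    \<open>x j = 0\<close>.\<close>
  moreover have "f \<noteq> t *\<^sub>C h" if "t \<in> \<Theta>" for t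
    using that x xj assms(4) by force
  ultimately show "\<not> does_PR \<Theta> G"
    unfolding does_PR_def by blast
qed

end
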